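(* There exist a countable discrete group $\Gamma$ and a Borel measure-preserving $\Gamma$-action on a standard $\sigma$-finite space $(X,\lambda)$ such that $X$ cannot be endowed with a locally compact Polish topology for which the $\Gamma$-action is continuous.
   Context: A standard Borel space is an uncountable measurable space whose $\sigma$-algebra is the Borel $\sigma$-algebra of some Polish topology. A standard $\sigma$-finite space $(X,\lambda)$ is a standard Borel space $X$ with a nontrivial (nonzero) atomless $\sigma$-finite Borel measure $\lambda$. A Borel measure-preserving $\Gamma$-action is a group action of $\Gamma$ on $X$ by Borel bijections preserving $\lambda$. *)

theory Defs
  imports "HOL-Analysis.Analysis" "HOL-Algebra.Group_Action"
begin

definition polish_topology :: "'a topology \<Rightarrow> bool" where
  "polish_topology T \<longleftrightarrow> completely_metrizable_space T \<and> separable_space T"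

definition standard_borel_space :: "'a measure \<Rightarrow> bool" where
  "standard_borel_space M \<longleftrightarrow>
     uncountable (space M) \<and>
     (\<exists>T. polish_topology T \<and> topspace T = space M \<and>
          sets M = sigma_sets (topspace T) {U. openin T U})"

text \<open>Every set of positive measure has a measurable subset of strictly smaller positive
  measure. A set of infinite measure is covered by the strict inequality as well; for
  sigma-finite measures this agrees with the absence of atoms.\<close>

definition atomless :: "'a measure \<Rightarrow> bool" where
  "atomless M \<longleftrightarrow>
     (\<forall>A\<in>sets M. 0 < emeasure M A \<longrightarrow>
        (\<exists>B\<in>sets M. B \<subseteq> A \<and> 0 < emeasure M B \<and> emeasure M B < emeasure M A))"

text \<open>The measurable space and its measure are carried by the same object \<open>M\<close>.\<close>

definition standard_sigma_finite_space :: "'a measure \<Rightarrow> bool" where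
  "standard_sigma_finite_space M \<longleftrightarrow>
     standard_borel_space M \<and> sigma_finite_measure M \<and>
     emeasure M (space M) \<noteq> 0 \<and> atomless M"

text \<open>Measurability of the inverse of each \<open>\<phi> g\<close> need not be stated separately: on \<open>space M\<close>
  it coincides with \<open>\<phi>\<close> applied to the inverse of \<open>g\<close>.\<close>

definition borel_mp_action ::
    "('g, 'b) monoid_scheme \<Rightarrow> 'a measure \<Rightarrow> ('g \<Rightarrow> 'a \<Rightarrow> 'a) \<Rightarrow> bool" where
  "borel_mp_action G M \<phi> \<longleftrightarrow>
     group_action G (space M) \<phi> \<and>
     (\<forall>g\<in>carrier G. \<phi> g \<in> measurable M M \<and>
        (\<forall>A\<in>sets M. emeasure M (\<phi> g -` A \<inter> space M) = emeasure M A))"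

text \<open>Joint continuity of the action map, the group being discrete.\<close>

definition continuous_action ::
    "('g, 'b) monoid_scheme \<Rightarrow> 'a topology \<Rightarrow> ('g \<Rightarrow> 'a \<Rightarrow> 'a) \<Rightarrow> bool" where
  "continuous_action G T \<phi> \<longleftrightarrow>
     continuous_map (prod_topology (discrete_topology (carrier G)) T) T (\<lambda>(g, x). \<phi> g x)"

end

theory Submission
  imports Defs "HOL-Algebra.Generated_Groups" "HOL-Algebra.Weak_Morphisms"
begin

text \<open>The space is the set of irrational numbers with Lebesgue measure, and the group is generated
  by the flips \<open>x \<mapsto> p + q - x\<close> of the intervals with rational endpoints, extended by the identity.
  The fixed point set of a flip is the complement of its interval, so in any Hausdorff topology
  making the action continuous the rational intervals are open. Such a topology therefore refines
  the Euclidean one. If it were moreover Polish and locally compact, hence sigma-compact, the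
  irrational numbers would be a countable union of Euclidean compact sets, contradicting Baire's
  theorem.\<close>

section \<open>Countability and sigma-compactness\<close>

text \<open>Generated elements are products of finite words in the generators and their inverses,
  and a countable alphabet has only countably many words.\<close>

lemma (in group) countable_generate:
  assumes "countable S" "S \<subseteq> carrier G"
  shows "countable (generate G S)"
proof -
  let ?A = "S \<union> m_inv G ` S"
  let ?w = "\<lambda>xs. foldr (\<otimes>) xs \<one>"
  have closed: "?w xs \<in> carrier G" if "xs \<in> lists ?A" for xs
    using that assms(2) by (induction xs) auto
  have append: "?w (xs @ ys) = ?w xs \<otimes> ?w ys" if "xs \<in> lists ?A" "ys \<in> lists ?A" for xs ys
    using that(1)
  proof (induction xs)
    case Nil
    show ?case using closed[OF that(2)] by simp
  next
    case (Cons x xs)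
    then have "x \<in> carrier G" "xs \<in> lists ?A" using assms(2) by auto
    then show ?case
      using Cons closed[OF that(2)] closed[of xs] by (simp add: m_assoc)
  qed
  have "generate G S \<subseteq> ?w ` lists ?A"
  proof
    fix h assume "h \<in> generate G S"
    then show "h \<in> ?w ` lists ?A"
    proof induction
      case one
      show ?case by (rule image_eqI[of _ _ "[]"]) auto
    next
      case (incl h)
      then show ?case using assms(2) by (intro image_eqI[of _ _ "[h]"]) auto
    next
      case (inv h)
      then show ?case using assms(2) by (intro image_eqI[of _ _ "[inv h]"]) auto
    next
      case (eng h1 h2)
      then obtain xs ys where "xs \<in> lists ?A" "ys \<in> lists ?A" "h1 = ?w xs" "h2 = ?w ys"
        by blast
      then show ?case using append[of xs ys] by (intro image_eqI[of _ _ "xs @ ys"]) auto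
    qed
  qed
  moreover have "countable (?w ` lists ?A)"
    using assms(1) by (intro countable_image countable_lists) auto
  ultimately show ?thesis by (rule countable_subset)
qed

text \<open>The balls of radius \<open>1 / (n + 1)\<close> around the points of a countable dense
  set form a base.\<close>

lemma metrizable_separable_imp_second_countable:
  assumes "metrizable_space T" "separable_space T"
  shows "second_countable T"
proof -
  obtain M d where "Metric_space M d" and T: "T = Metric_space.mtopology M d"
    using assms(1) unfolding metrizable_space_def by blast
  interpret Metric_space M d by fact
  obtain C where C: "countable C" "C \<subseteq> M" "mtopology closure_of C = M"
    using assms(2) unfolding separable_space_def T by auto
  let ?B = "(\<lambda>(c, n::nat). mball c (inverse (Suc n))) ` (C \<times> UNIV)"
  have "\<exists>V\<in>?B. x \<in> V \<and> V \<subseteq> U" if U: "openin mtopology U" "x \<in> U" for U x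
  proof -
    obtain r where r: "r > 0" "mball x r \<subseteq> U" and x: "x \<in> M"
      using U unfolding openin_mtopology by blast
    \<comment> \<open>With a radius below \<open>r / 2\<close>, the triangle inequality keeps a ball
      that contains \<open>x\<close> inside \<open>mball x r\<close>.\<close>
    obtain n where n: "inverse (real (Suc n)) < r / 2"
      using reals_Archimedean[of "r / 2"] r(1) by auto
    have "\<forall>r>0. \<exists>y\<in>C. y \<in> mball x r"
      using C(3) x unfolding metric_closure_of by blast
    moreover have "0 < inverse (real (Suc n))" by simp
    ultimately obtain c where c: "c \<in> C" "c \<in> mball x (inverse (Suc n))"
      by blast
    have "mball c (inverse (Suc n)) \<subseteq> mball x r"
    proof
      fix y assume y: "y \<in> mball c (inverse (Suc n))"
      then show "y \<in> mball x r"
        using c n x triangle[of x c y] by (auto simp: in_mball)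
    qed
    moreover have "x \<in> mball c (inverse (Suc n))"
      using c by (simp add: commute)
    ultimately show ?thesis
      using r(2) c(1) by blast
  qed
  moreover have "countable ?B" using C(1) by blast
  moreover have "\<forall>V\<in>?B. openin mtopology V" by auto
  ultimately show ?thesis
    unfolding second_countable_def T by (intro exI[of _ ?B]) simp
qed

text \<open>Local compactness covers the space by open sets lying in compact ones. The Lindelof
  property leaves countably many of them, and their compact hulls form \<open>\<K>\<close>.\<close>

lemma polish_locally_compact_imp_sigma_compact:
  assumes "polish_topology T" "locally_compact_space T"
  obtains \<K> where "countable \<K>" "\<And>K. K \<in> \<K> \<Longrightarrow> compactin T K" "\<Union>\<K> = topspace T"
proof -
  have "second_countable T"
    using assms(1) metrizable_separable_imp_second_countable
      completely_metrizable_imp_metrizable_space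
    unfolding polish_topology_def by blast
  then have L: "Lindelof_space T" by (rule second_countable_imp_Lindelof_space)
  let ?U = "{U. openin T U \<and> (\<exists>K. compactin T K \<and> U \<subseteq> K)}"
  have "\<Union>?U = topspace T"
    using assms(2) openin_subset unfolding locally_compact_space_def by fast
  then obtain V where V: "countable V" "V \<subseteq> ?U" "\<Union>V = topspace T"
    using Lindelof_spaceD[OF L, of ?U] by auto
  then have "\<forall>U\<in>V. \<exists>K. compactin T K \<and> U \<subseteq> K" by blast
  from bchoice[OF this] obtain k where k: "\<forall>U\<in>V. compactin T (k U) \<and> U \<subseteq> k U" ..
  show thesis
  proof (rule that)
    show "countable (k ` V)" using V(1) by simp
    show "compactin T K" if "K \<in> k ` V" for K using that k by auto
    have "\<Union>V \<subseteq> \<Union>(k ` V)" using k by blast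
    moreover have "\<Union>(k ` V) \<subseteq> topspace T" using k compactin_subset_topspace by blast
    ultimately show "\<Union>(k ` V) = topspace T" using V(3) by simp
  qed
qed

section \<open>The space of irrational numbers\<close>

abbreviation irrat :: "real set" where "irrat \<equiv> - \<rat>"

abbreviation irrat_measure :: "real measure" where
  "irrat_measure \<equiv> restrict_space lborel irrat"

lemma irrat_borel [measurable]: "irrat \<in> sets borel"
  by (rule borel_comp[OF sets.countable[OF _ countable_rat]]) simp

lemma space_irrat_measure [simp]: "space irrat_measure = irrat"
  by (simp add: space_restrict_space)

lemma sets_irrat_measure: "A \<in> sets irrat_measure \<longleftrightarrow> A \<subseteq> irrat \<and> A \<in> sets borel"
  by (subst sets_restrict_space_iff) auto

lemma emeasure_irrat_measure:
  "A \<subseteq> irrat \<Longrightarrow> emeasure irrat_measure A = emeasure lborel A"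
  by (rule emeasure_restrict_space) auto

lemma uncountable_irrat: "uncountable irrat"
proof
  assume "countable irrat"
  then have "countable (irrat \<union> \<rat>)" using countable_rat by (rule countable_Un)
  then show False by (simp add: uncountable_UNIV_real Un_commute)
qed

text \<open>Otherwise the compact sets together with the rational singletons would be countably many
  closed sets with empty interior covering the line, against Baire.\<close>

lemma not_sigma_compact_irrat:
  assumes "countable \<K>" "\<And>K. K \<in> \<K> \<Longrightarrow> compact K"
  shows "\<Union>\<K> \<noteq> irrat"
proof
  assume eq: "\<Union>\<K> = irrat"
  let ?G = "\<K> \<union> (\<lambda>x. {x}) ` \<rat>"
  have "euclidean interior_of \<Union>?G = {}"
  proof (rule Baire_category_alt)
    show "completely_metrizable_space (euclidean :: real topology) \<or>
      locally_compact_space (euclidean :: real topology) \<and> regular_space (euclidean :: real topology)"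
      using completely_metrizable_space_euclidean by blast
    show "countable ?G" using assms(1) countable_rat by blast
    fix S assume S: "S \<in> ?G"
    have "interior S = {}" if "S \<in> \<K>"
    proof (rule ccontr)
      assume "interior S \<noteq> {}"
      then have "interior S \<inter> closure \<rat> \<noteq> {}" by (simp add: Rats_closure_real)
      then have "interior S \<inter> \<rat> \<noteq> {}" by (simp add: open_Int_closure_eq_empty)
      then obtain q where "q \<in> \<rat>" "q \<in> interior S" by blast
      then show False using that eq interior_subset by blast
    qed
    then show "closedin euclidean S \<and> euclidean interior_of S = {}"
      using S assms(2) by (auto simp: compact_imp_closed)
  qed
  moreover have "\<Union>?G = UNIV" using eq by auto
  ultimately show False by simp
qed

section \<open>The irrationals as a standard sigma-finite space\<close>

lemma standard_borel_irrat: "standard_borel_space irrat_measure"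
  unfolding standard_borel_space_def
proof (intro conjI exI)
  let ?T = "top_of_set irrat"
  show "uncountable (space irrat_measure)" by (simp add: uncountable_irrat)
  \<comment> \<open>A G-delta subset of a completely metrizable space is completely metrizable in
    the subspace topology.\<close>
  have "gdelta_in euclidean (\<Inter>q\<in>\<rat>. - {q::real})"
    using countable_rat
    by (intro gdelta_in_Inter) (auto intro!: open_imp_gdelta_in simp flip: open_openin)
  moreover have "(\<Inter>q\<in>\<rat>. - {q::real}) = irrat" by auto
  ultimately have "completely_metrizable_space ?T"
    by (metis completely_metrizable_space_euclidean completely_metrizable_space_gdelta_in)
  \<comment> \<open>Separability alone need not pass to subspaces; second countability does, and it
    implies separability.\<close>
  moreover have "second_countable (euclidean :: real topology)"
  proof (rule metrizable_separable_imp_second_countable)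
    show "metrizable_space (euclidean :: real topology)"
      by (intro completely_metrizable_imp_metrizable_space completely_metrizable_space_euclidean)
    show "separable_space (euclidean :: real topology)"
      unfolding separable_space_def using countable_rat Rats_closure_real
      by (intro exI[of _ "\<rat>"]) simp
  qed
  ultimately show "polish_topology ?T"
    unfolding polish_topology_def
    by (simp add: second_countable_subtopology second_countable_imp_separable_space)
  show "topspace ?T = space irrat_measure" by simp
  have "sets irrat_measure = (\<inter>) irrat ` sigma_sets UNIV {S. open S}"
    by (simp add: sets_restrict_space sets_borel)
  also have "\<dots> = sigma_sets irrat ((\<inter>) irrat ` {S. open S})"
    using irrat_borel by (intro sigma_sets_Int) (auto simp: sets_borel)
  also have "(\<inter>) irrat ` {S. open S} = {U. openin ?T U}"
    by (auto simp: openin_open)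
  finally show "sets irrat_measure = sigma_sets (topspace ?T) {U. openin ?T U}" by simp
qed

text \<open>Cut \<open>A\<close> into slices of length \<open>r\<close>, where \<open>r\<close> is
  below the measure of \<open>A\<close>. Countably many null slices would make \<open>A\<close>
  null, so some slice has positive measure, at most \<open>r\<close>.\<close>

lemma atomless_irrat: "atomless irrat_measure"
  unfolding atomless_def
proof (intro ballI impI)
  fix A assume "A \<in> sets irrat_measure" and pos: "0 < emeasure irrat_measure A"
  then have A: "A \<subseteq> irrat" "A \<in> sets borel" by (auto simp: sets_irrat_measure)
  then have pos': "0 < emeasure lborel A" using pos by (simp add: emeasure_irrat_measure)
  \<comment> \<open>Strictly below the measure of \<open>A\<close>, \<open>s\<close> is finite even
    when that measure is infinite.\<close>
  obtain s where s: "0 < s" "s < emeasure lborel A"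
    using pos' dense by blast
  then obtain r where "s = ennreal r" by (cases s) auto
  with s have r: "0 < r" "ennreal r < emeasure lborel A" by auto
  define J where "J k = {of_int k * r ..< (of_int k + 1) * r}" for k :: int
  have "\<exists>k. emeasure lborel (A \<inter> J k) \<noteq> 0"
  proof (rule ccontr)
    assume "\<not> ?thesis"
    then have "(\<Union>k. A \<inter> J k) \<in> null_sets lborel"
      using A(2) by (intro null_sets_UN) (auto simp: J_def null_sets_def)
    moreover have "x \<in> J \<lfloor>x / r\<rfloor>" for x
      using floor_divide_lower[OF r(1), of x] floor_divide_upper[OF r(1), of x] by (auto simp: J_def)
    then have "(\<Union>k. A \<inter> J k) = A" by blast
    ultimately show False using pos' by (auto simp: null_sets_def)
  qed
  then obtain k where k: "0 < emeasure lborel (A \<inter> J k)" by (auto simp: zero_less_iff_neq_zero)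
  have "emeasure lborel (A \<inter> J k) \<le> emeasure lborel (J k)"
    by (intro emeasure_mono) (auto simp: J_def)
  also have "\<dots> = ennreal r" using r(1) by (simp add: J_def algebra_simps)
  finally have "emeasure lborel (A \<inter> J k) < emeasure lborel A" using r(2) by simp
  moreover have "A \<inter> J k \<in> sets irrat_measure"
    using A by (auto simp: sets_irrat_measure J_def)
  ultimately show "\<exists>B\<in>sets irrat_measure. B \<subseteq> A \<and> 0 < emeasure irrat_measure B \<and>
      emeasure irrat_measure B < emeasure irrat_measure A"
    using k A(1) by (intro bexI[of _ "A \<inter> J k"]) (auto simp: emeasure_irrat_measure le_infI1)
qed

lemma standard_sigma_finite_irrat: "standard_sigma_finite_space irrat_measure"
  unfolding standard_sigma_finite_space_def
proof (intro conjI)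
  show "sigma_finite_measure irrat_measure"
    by (intro sigma_finite_measure_restrict_space sigma_finite_lborel) auto
  have "\<rat> \<in> null_sets (lborel :: real measure)"
    using countable_imp_null_set_lborel countable_rat by blast
  then have "emeasure lborel irrat = emeasure lborel (UNIV :: real set)"
    by (metis Compl_eq_Diff_UNIV emeasure_Diff_null_set sets_lborel borel_open open_UNIV)
  then show "emeasure irrat_measure (space irrat_measure) \<noteq> 0"
    by (simp add: emeasure_irrat_measure)
qed (rule standard_borel_irrat atomless_irrat)+

section \<open>Flips of rational intervals\<close>

text \<open>For \<open>q \<le> p\<close> the interval is empty and the map is the identity, so every
  pair of rationals can serve as an index.\<close>

definition flip :: "real \<Rightarrow> real \<Rightarrow> real \<Rightarrow> real" where
  "flip p q x = (if p < x \<and> x < q then p + q - x else x)"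

lemma flip_flip [simp]: "flip p q (flip p q x) = x"
  by (auto simp: flip_def)

lemma flip_irrat:
  assumes "p \<in> \<rat>" "q \<in> \<rat>" "x \<in> irrat"
  shows "flip p q x \<in> irrat"
proof
  assume "flip p q x \<in> \<rat>"
  then have "p + q - flip p q x \<in> \<rat>" using assms by simp
  moreover have "x = flip p q x \<or> x = p + q - flip p q x" by (simp add: flip_def)
  ultimately show False using assms \<open>flip p q x \<in> \<rat>\<close> by (metis ComplD)
qed

text \<open>The only fixed point inside the interval would be its midpoint, which is rational.\<close>

lemma flip_fixed_iff:
  assumes "p \<in> \<rat>" "q \<in> \<rat>" "x \<in> irrat"
  shows "flip p q x = x \<longleftrightarrow> x \<notin> {p<..<q}"
proof -
  have "p + q - x \<noteq> x"
  proof
    assume "p + q - x = x"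
    then have "x = (p + q) / 2" by simp
    moreover have "(p + q) / 2 \<in> \<rat>" using assms(1,2) by simp
    ultimately show False using assms(3) by blast
  qed
  then show ?thesis by (auto simp: flip_def)
qed

lemma borel_measurable_flip [measurable]: "flip p q \<in> borel_measurable borel"
  unfolding flip_def[abs_def] by measurable

text \<open>The reflection \<open>x \<mapsto> p + q - x\<close> preserves Lebesgue measure and maps
  the interval onto itself, so the parts of \<open>B\<close> inside and outside the interval can be
  treated separately.\<close>

lemma emeasure_flip:
  assumes [measurable]: "B \<in> sets borel"
  shows "emeasure lborel (flip p q -` B) = emeasure lborel B"
proof -
  let ?s = "\<lambda>x::real. p + q - x" and ?I = "{p<..<q}"
  \<comment> \<open>Affine change of variables with slope -1, whose density factor is 1.\<close>
  have "distr lborel borel ?s = lborel"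
    by (subst (2) lborel_real_affine[of "-1" "p + q"]) (simp_all add: density_1)
  moreover have "emeasure (distr lborel borel ?s) (B \<inter> ?I) = emeasure lborel (?s -` (B \<inter> ?I))"
    by (subst emeasure_distr) auto
  ultimately have s: "emeasure lborel (?s -` (B \<inter> ?I)) = emeasure lborel (B \<inter> ?I)" by simp
  have m: "?s -` (B \<inter> ?I) \<in> sets borel"
    using measurable_sets[of ?s borel borel "B \<inter> ?I"] by simp
  have "flip p q -` B = ?s -` (B \<inter> ?I) \<union> (B - ?I)"
    by (auto simp: flip_def split: if_splits)
  moreover have "emeasure lborel (?s -` (B \<inter> ?I) \<union> (B - ?I)) =
      emeasure lborel (?s -` (B \<inter> ?I)) + emeasure lborel (B - ?I)"
    using m by (intro plus_emeasure[symmetric]) auto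
  moreover have "emeasure lborel (B \<inter> ?I) + emeasure lborel (B - ?I) = emeasure lborel B"
    by (subst plus_emeasure) (auto simp: Int_Diff_Un)
  ultimately show ?thesis using s by simp
qed

section \<open>The group generated by the flips\<close>

text \<open>Elements of \<open>BijGroup irrat\<close> must be \<open>undefined\<close> off
  \<open>irrat\<close>, hence \<open>restrict\<close>. Rational endpoints keep the family
  countable.\<close>

definition flips :: "(real \<Rightarrow> real) set" where
  "flips = (\<lambda>(p, q). restrict (flip p q) irrat) ` (\<rat> \<times> \<rat>)"

text \<open>The condition that \<open>borel_mp_action\<close> puts on a single group element,
  isolated so that it can be carried through the generated group by induction.\<close>

definition measure_preserving_map :: "'a measure \<Rightarrow> ('a \<Rightarrow> 'a) \<Rightarrow> bool" where
  "measure_preserving_map M f \<longleftrightarrow>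
     f \<in> measurable M M \<and> (\<forall>A\<in>sets M. emeasure M (f -` A \<inter> space M) = emeasure M A)"

text \<open>Serves to trade the \<open>restrict\<close> and \<open>compose\<close> of
  \<open>BijGroup\<close> for plain functions with the same values on the space.\<close>

lemma measure_preserving_map_cong:
  assumes "\<And>x. x \<in> space M \<Longrightarrow> f x = g x"
  shows "measure_preserving_map M f \<longleftrightarrow> measure_preserving_map M g"
proof -
  have "f -` A \<inter> space M = g -` A \<inter> space M" for A using assms by auto
  then show ?thesis
    unfolding measure_preserving_map_def using measurable_cong[of M f g M] assms by simp
qed

lemma measure_preserving_map_comp:
  assumes "measure_preserving_map M f" "measure_preserving_map M g"
  shows "measure_preserving_map M (f \<circ> g)"
  unfolding measure_preserving_map_def
proof (intro conjI ballI)
  show "f \<circ> g \<in> measurable M M"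
    using assms by (auto simp: measure_preserving_map_def)
  fix A assume A: "A \<in> sets M"
  let ?B = "f -` A \<inter> space M"
  have "?B \<in> sets M"
    using A assms(1) by (auto simp: measure_preserving_map_def)
  moreover have "(f \<circ> g) -` A \<inter> space M = g -` ?B \<inter> space M"
    using assms(2) by (auto simp: measure_preserving_map_def dest: measurable_space)
  ultimately show "emeasure M ((f \<circ> g) -` A \<inter> space M) = emeasure M A"
    using A assms unfolding measure_preserving_map_def by (simp del: vimage_Int)
qed

lemma flips_subset_Bij: "flips \<subseteq> carrier (BijGroup irrat)"
proof
  fix f assume "f \<in> flips"
  then obtain p q where pq: "p \<in> \<rat>" "q \<in> \<rat>" "f = restrict (flip p q) irrat"
    by (auto simp: flips_def)
  then have "bij_betw f irrat irrat"
    by (intro bij_betw_byWitness[where f' = f]) (auto simp: flip_irrat[simplified])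
  then show "f \<in> carrier (BijGroup irrat)"
    using pq(3) by (simp add: BijGroup_def Bij_def)
qed

text \<open>Reduces the case of inverse generators, in an induction over \<open>generate\<close>, to
  that of generators.\<close>

lemma flips_involution:
  assumes "f \<in> flips"
  shows "inv\<^bsub>BijGroup irrat\<^esub> f = f"
proof (rule group.inv_equality[OF group_BijGroup])
  show f: "f \<in> carrier (BijGroup irrat)" "f \<in> carrier (BijGroup irrat)"
    using assms flips_subset_Bij by auto
  obtain p q where "p \<in> \<rat>" "q \<in> \<rat>" "f = restrict (flip p q) irrat"
    using assms by (auto simp: flips_def)
  then have "compose irrat f f = (\<lambda>x\<in>irrat. x)"
    by (auto simp: compose_def flip_irrat[simplified] intro!: restrict_ext)
  then show "f \<otimes>\<^bsub>BijGroup irrat\<^esub> f = \<one>\<^bsub>BijGroup irrat\<^esub>"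
    using f by (simp add: BijGroup_def)
qed

lemma measure_preserving_flips:
  assumes "f \<in> flips"
  shows "measure_preserving_map irrat_measure f"
proof -
  obtain p q where pq: "p \<in> \<rat>" "q \<in> \<rat>" and f: "f = restrict (flip p q) irrat"
    using assms by (auto simp: flips_def)
  have "measure_preserving_map irrat_measure (flip p q)"
    unfolding measure_preserving_map_def
  proof (intro conjI ballI)
    have "flip p q \<in> measurable lborel lborel" by simp
    then show "flip p q \<in> measurable irrat_measure irrat_measure"
      using pq by (intro measurable_restrict_space3) (auto simp: flip_irrat[simplified])
    fix A assume "A \<in> sets irrat_measure"
    then have A: "A \<subseteq> irrat" "A \<in> sets borel" by (auto simp: sets_irrat_measure)
    \<comment> \<open>By involutivity, \<open>x\<close> is the flip of its own image, so it is
      irrational when that image is. Hence intersecting with the space changes nothing, and the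
      measure on the line applies.\<close>
    have "flip p q -` A \<subseteq> irrat"
    proof
      fix x assume "x \<in> flip p q -` A"
      then show "x \<in> irrat" using flip_irrat[OF pq, of "flip p q x"] A(1) by auto
    qed
    then show "emeasure irrat_measure (flip p q -` A \<inter> space irrat_measure) =
        emeasure irrat_measure A"
      using A by (simp add: emeasure_irrat_measure emeasure_flip Int_absorb2)
  qed
  then show ?thesis
    by (subst measure_preserving_map_cong[of _ _ "flip p q"]) (auto simp: f)
qed

lemma measure_preserving_generate_flips:
  assumes "f \<in> generate (BijGroup irrat) flips"
  shows "measure_preserving_map irrat_measure f"
  using assms
proof induction
  case one
  have "measure_preserving_map irrat_measure (\<lambda>x. x)"
    by (auto simp: measure_preserving_map_def sets_irrat_measure Int_absorb2)
  then show ?case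
    by (subst measure_preserving_map_cong[of _ _ "\<lambda>x. x"]) (auto simp: BijGroup_def)
next
  case (incl h)
  then show ?case by (rule measure_preserving_flips)
next
  case (inv h)
  then show ?case using flips_involution measure_preserving_flips by simp
next
  case (eng h1 h2)
  have "h1 \<in> Bij irrat" "h2 \<in> Bij irrat"
    using group.generate_in_carrier[OF group_BijGroup flips_subset_Bij eng.hyps(1)]
      group.generate_in_carrier[OF group_BijGroup flips_subset_Bij eng.hyps(2)]
    by (simp_all add: BijGroup_def)
  \<comment> \<open>The group product is \<open>compose irrat\<close>, which agrees with
    \<open>h1 \<circ> h2\<close> on \<open>irrat\<close>.\<close>
  then have "(h1 \<otimes>\<^bsub>BijGroup irrat\<^esub> h2) x = (h1 \<circ> h2) x" if "x \<in> space irrat_measure" for x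
    using that by (simp add: BijGroup_def compose_def)
  then show ?case
    using measure_preserving_map_cong measure_preserving_map_comp[OF eng.IH] by blast
qed

section \<open>Topologies in which the flips are continuous\<close>

text \<open>That \<open>T\<close> refines the Euclidean topology is phrased as continuity of the
  inclusion, the form in which compact sets can be pushed forward to the line.\<close>

lemma continuous_flips_imp_finer:
  assumes "topspace T = irrat" "Hausdorff_space T"
    and cont: "\<And>f. f \<in> flips \<Longrightarrow> continuous_map T T f"
  shows "continuous_map T euclidean (\<lambda>x. x)"
proof -
  have interval: "openin T ({p<..<q} - \<rat>)" if "p \<in> \<rat>" "q \<in> \<rat>" for p q
  proof -
    let ?f = "restrict (flip p q) irrat"
    have "?f \<in> flips"
      unfolding flips_def using that by (intro image_eqI[of _ _ "(p, q)"]) simp_all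
    \<comment> \<open>The fixed points are the equalizer of the flip and the identity, which is
      closed in a Hausdorff space.\<close>
    then have "closedin T {x \<in> topspace T. ?f x = x}"
      using cont assms(2) by (intro closedin_continuous_maps_eq) (auto simp del: restrict_apply)
    moreover have "{x \<in> topspace T. ?f x = x} = topspace T - ({p<..<q} - \<rat>)"
      using flip_fixed_iff[OF that] assms(1) by auto
    ultimately show ?thesis
      using assms(1) by (subst openin_closedin_eq) auto
  qed
  have "openin T (U - \<rat>)" if "open U" for U :: "real set"
  proof (subst openin_subopen, intro ballI)
    fix x assume x: "x \<in> U - \<rat>"
    then obtain e where e: "e > 0" "ball x e \<subseteq> U"
      using \<open>open U\<close> openE by blast
    obtain p q where pq: "p \<in> \<rat>" "x - e < p" "p < x" "q \<in> \<rat>" "x < q" "q < x + e"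
      using Rats_dense_in_real[of "x - e" x] Rats_dense_in_real[of x "x + e"] e(1) by auto
    then have "{p<..<q} \<subseteq> ball x e" by (auto simp: dist_real_def)
    then show "\<exists>V. openin T V \<and> x \<in> V \<and> V \<subseteq> U - \<rat>"
      using interval[OF pq(1,4)] pq e(2) x by (intro exI[of _ "{p<..<q} - \<rat>"]) auto
  qed
  moreover have "{x \<in> topspace T. x \<in> U} = U - \<rat>" for U
    using assms(1) by auto
  ultimately show ?thesis by (simp add: continuous_map)
qed

lemma no_locally_compact_polish_topology_flips:
  assumes "topspace T = irrat" "polish_topology T" "locally_compact_space T"
  shows "\<exists>f\<in>flips. \<not> continuous_map T T f"
proof (rule ccontr)
  assume "\<not> ?thesis"
  moreover have "Hausdorff_space T"
    using assms(2) unfolding polish_topology_def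
    by (blast intro: completely_metrizable_imp_metrizable_space metrizable_imp_Hausdorff_space)
  ultimately have id: "continuous_map T euclidean (\<lambda>x. x)"
    using continuous_flips_imp_finer[OF assms(1)] by blast
  obtain \<K> where K: "countable \<K>" "\<And>K. K \<in> \<K> \<Longrightarrow> compactin T K" "\<Union>\<K> = topspace T"
    using polish_locally_compact_imp_sigma_compact[OF assms(2,3)] by blast
  \<comment> \<open>The inclusion maps a \<open>T\<close>-compact set to itself, now compact in the
    Euclidean sense.\<close>
  have "compact K" if "K \<in> \<K>" for K
    using image_compactin[OF K(2)[OF that] id] by simp
  then show False
    using not_sigma_compact_irrat[OF K(1)] K(3) assms(1) by simp
qed

section \<open>From the flips to an action of a countable group\<close>

lemma continuous_action_imp_continuous_map:
  assumes "continuous_action G T \<phi>" "g \<in> carrier G"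
  shows "continuous_map T T (\<phi> g)"
proof -
  have "continuous_map T (prod_topology (discrete_topology (carrier G)) T) (\<lambda>x. (g, x))"
    using assms(2) by (auto intro: continuous_map_pairedI)
  from continuous_map_compose[OF this assms(1)[unfolded continuous_action_def]]
  show ?thesis by (simp add: o_def)
qed

theorem proposition5p6:
  shows "\<exists>(G :: nat monoid) (M :: real measure) (\<phi> :: nat \<Rightarrow> real \<Rightarrow> real).
           group G \<and> countable (carrier G) \<and>
           standard_sigma_finite_space M \<and>
           borel_mp_action G M \<phi> \<and>
           \<not> (\<exists>T :: real topology.
                 topspace T = space M \<and> polish_topology T \<and> locally_compact_space T \<and>
                 continuous_action G T \<phi>)"
proof -
  let ?B = "BijGroup irrat"
  define F where "F = generate ?B flips"
  define H where "H = ?B\<lparr>carrier := F\<rparr>"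
  interpret B: group ?B by (rule group_BijGroup)
  have sub: "subgroup F ?B"
    unfolding F_def by (rule B.generate_is_subgroup[OF flips_subset_Bij])
  have "countable flips" unfolding flips_def by (intro countable_image countable_SIGMA countable_rat)
  then have "countable F" unfolding F_def by (rule B.countable_generate[OF _ flips_subset_Bij])
  interpret H: group H
    unfolding H_def using sub by (rule B.subgroup_imp_group)
  \<comment> \<open>The required group lives on \<open>nat\<close>. As \<open>F\<close> is
    countable, its elements can be numbered injectively and the group structure transported along
    the numbering; \<open>\<phi>\<close> decodes a number back into the bijection that it stands
    for.\<close>
  define e where "e = to_nat_on F"
  have inj: "inj_on e (carrier H)"
    using \<open>countable F\<close> by (simp add: e_def H_def inj_on_to_nat_on)
  define G where "G = image_group e H"
  define \<phi> where "\<phi> = inv_into F e"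
  have iso: "e \<in> iso H G"
    unfolding G_def by (rule inj_imp_image_group_iso[OF inj])
  have "group G"
    unfolding G_def by (rule H.inj_imp_image_group_is_group[OF inj])
  have "\<phi> \<in> iso G H"
    using H.iso_set_sym[OF iso] by (simp add: \<phi>_def H_def)
  then have \<phi>_carrier: "\<phi> ` carrier G = F" and hom: "\<phi> \<in> hom G H"
    by (simp_all add: iso_def H_def bij_betw_def)
  \<comment> \<open>A \<open>group_action\<close> is a homomorphism into the full group of
    bijections, so the target is enlarged from \<open>H\<close>.\<close>
  have "\<phi> \<in> hom G ?B"
    using hom subgroup.subset[OF sub] unfolding hom_def H_def by (simp add: Pi_iff subset_iff)
  then have "group_action G irrat \<phi>"
    using \<open>group G\<close> B.group_axioms
    by (simp add: group_action_def group_hom_def group_hom_axioms_def)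
  moreover have "measure_preserving_map irrat_measure (\<phi> g)" if "g \<in> carrier G" for g
    using that \<phi>_carrier measure_preserving_generate_flips unfolding F_def by blast
  ultimately have "borel_mp_action G irrat_measure \<phi>"
    by (simp add: borel_mp_action_def measure_preserving_map_def)
  moreover have "\<not> (topspace T = irrat \<and> polish_topology T \<and> locally_compact_space T \<and>
      continuous_action G T \<phi>)" for T :: "real topology"
  proof
    assume T: "topspace T = irrat \<and> polish_topology T \<and> locally_compact_space T \<and>
      continuous_action G T \<phi>"
    then obtain f where f: "f \<in> flips" "\<not> continuous_map T T f"
      using no_locally_compact_polish_topology_flips by blast
    \<comment> \<open>The discontinuous flip is a generator, so some element of \<open>G\<close>
      acts by it.\<close>
    have "f \<in> \<phi> ` carrier G"
      unfolding \<phi>_carrier F_def using f(1) by (rule generate.incl)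
    then obtain g where "g \<in> carrier G" "f = \<phi> g" by blast
    then show False
      using T f(2) continuous_action_imp_continuous_map[of G T \<phi> g] by simp
  qed
  ultimately show ?thesis
    using \<open>group G\<close> standard_sigma_finite_irrat
    by (intro exI[of _ G] exI[of _ irrat_measure] exI[of _ \<phi>])
      (simp only: space_irrat_measure countableI_type not_ex simp_thms)
qed

end
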